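(* Let $C=(C(t))_{t\in\mathbb{R}}$ be a strongly continuous cosine family on a Banach space $X$. If $$\limsup_{t\to 0^{+}}\|C(t)-I\|<2,$$ then $\lim_{t\to 0^{+}}\|C(t)-I\|=0$.
   Context: A family $C=(C(t))_{t\in\mathbb{R}}$ of bounded linear operators on a Banach space $X$ is called a cosine family if $C(0)=I$ and $2C(t)C(s)=C(t+s)+C(t-s)$ for all $t,s\in\mathbb{R}$. It is strongly continuous if $\lim_{h\to 0}C(t+h)x=C(t)x$ for all $x\in X$ and all $t\in\mathbb{R}$. $I$ is the identity operator and $\|\cdot\|$ on operators is the operator norm. *)

theory Defs
  imports "HOL-Analysis.Analysis"
begin

text \<open>The Banach space is a type of class \<open>banach\<close>, i.e. over the real scalars. This covers complex
  Banach spaces as well: restricting scalars keeps the norm, and every complex-linear bounded operator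
  is a real-linear one with the same operator norm. The norm on
  \<open>'a \<Rightarrow>\<^sub>L 'a\<close> is the operator norm.\<close>

definition cosine_family :: "(real \<Rightarrow> 'a::banach \<Rightarrow>\<^sub>L 'a) \<Rightarrow> bool" where
  "cosine_family C \<longleftrightarrow>
     C 0 = id_blinfun \<and>
     (\<forall>t s. 2 *\<^sub>R (C t o\<^sub>L C s) = C (t + s) + C (t - s))"

definition strongly_continuous :: "(real \<Rightarrow> 'a::banach \<Rightarrow>\<^sub>L 'a) \<Rightarrow> bool" where
  "strongly_continuous C \<longleftrightarrow>
     (\<forall>x t. ((\<lambda>h. blinfun_apply (C (t + h)) x) \<longlongrightarrow> blinfun_apply (C t) x) (at 0))"

end

theory Submission imports Defs begin

text \<open>
  Heuristically \<open>C(t) = cos(tB)\<close>.  If \<open>C(t)\<close> did not tend to the identity in norm, then the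
  spectrum of \<open>B\<close> would contain arbitrarily large frequencies \<open>\<lambda>\<close>, and \<open>t\<lambda>\<close> would run through
  many periods while \<open>t\<close> runs through a short interval \<open>[0, h]\<close>.  The mean of
  \<open>(I - C(t))\<^sup>k\<close> over \<open>[0, h]\<close> would then act on such a frequency approximately like the mean of
  \<open>(1 - cos \<theta>)\<^sup>k\<close> over a full period.  That mean is \<open>(2k choose k) / 2\<^sup>k\<close>, which is of order
  \<open>2\<^sup>k / \<surd>k\<close>, whereas the hypothesis bounds the norm by \<open>c\<^sup>k\<close> for some \<open>c < 2\<close>.  For large
  \<open>k\<close> these two facts are incompatible.

  The rigorous version uses no spectral theory.  The cosine equation gives the expansion
  \<open>(I - C(t))\<^sup>k = 2\<^sup>-\<^sup>k \<Sum>j\<le>2k. (-1)\<^sup>k\<^sup>+\<^sup>j (2k choose j) C((k - j) t)\<close>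
  (lemma \<open>cosine_power_expansion\<close>), whose term for \<open>j = k\<close> is the constant
  \<open>(2k choose k) / 2\<^sup>k\<close>.  Apply both sides to \<open>y = C(s)x - x\<close> and integrate over
  \<open>t \<in> [0, h]\<close>.  For \<open>m \<noteq> 0\<close> the function \<open>t \<mapsto> C(mt)y\<close> is a combination of differences of
  translates of \<open>t \<mapsto> C(mt)x\<close>, so its integral is only \<open>O(s \<parallel>x\<parallel>)\<close>
  (lemma \<open>norm_integral_cosine_increment_le\<close>).  What remains is
  \<open>((2k choose k) / 2\<^sup>k - c\<^sup>k) \<parallel>y\<parallel> \<le> O(s \<parallel>x\<parallel>)\<close>, and for large \<open>k\<close> the factor on the left is
  positive.  Hence \<open>\<parallel>C(s) - I\<parallel> = O(s)\<close> as \<open>s\<close> tends to \<open>0\<close> from the right.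
\<close>

section \<open>Powers of \<open>I - C(t)\<close>\<close>

text \<open>Pascal's rule, read as: an \<open>(n + 1)\<close>-fold difference is the \<open>n\<close>-fold difference of a difference.\<close>

lemma alternating_binomial_sum_diff:
  fixes g :: "nat \<Rightarrow> 'v::real_vector"
  shows "(\<Sum>j\<le>n. ((-1)^j * real (n choose j)) *\<^sub>R (g j - g (Suc j)))
       = (\<Sum>j\<le>Suc n. ((-1)^j * real (Suc n choose j)) *\<^sub>R g j)"
proof -
  have "(\<Sum>j\<le>n. ((-1)^j * real (n choose j)) *\<^sub>R g j)
      = (\<Sum>j\<le>Suc n. ((-1)^j * real (n choose j)) *\<^sub>R g j)"
    by simp
  also have "\<dots> = g 0 - (\<Sum>j\<le>n. ((-1)^j * real (n choose Suc j)) *\<^sub>R g (Suc j))"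
    by (subst sum.atMost_Suc_shift) (simp add: sum_negf)
  finally have "(\<Sum>j\<le>n. ((-1)^j * real (n choose j)) *\<^sub>R (g j - g (Suc j)))
      = g 0 - (\<Sum>j\<le>n. ((-1)^j * real (n choose Suc j)) *\<^sub>R g (Suc j))
            - (\<Sum>j\<le>n. ((-1)^j * real (n choose j)) *\<^sub>R g (Suc j))"
    by (simp add: scaleR_diff_right sum_subtractf)
  also have "\<dots> = g 0 - (\<Sum>j\<le>n. ((-1)^j * real (Suc n choose Suc j)) *\<^sub>R g (Suc j))"
    by (simp add: sum.distrib algebra_simps)
  also have "\<dots> = (\<Sum>j\<le>Suc n. ((-1)^j * real (Suc n choose j)) *\<^sub>R g j)"
    by (subst sum.atMost_Suc_shift) (simp add: sum_negf)
  finally show ?thesis .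
qed

lemma alternating_binomial_sum_second_diff:
  fixes g :: "nat \<Rightarrow> 'v::real_vector"
  shows "(\<Sum>j\<le>n. ((-1)^j * real (n choose j)) *\<^sub>R (g j - 2 *\<^sub>R g (Suc j) + g (Suc (Suc j))))
       = (\<Sum>j\<le>Suc (Suc n). ((-1)^j * real (Suc (Suc n) choose j)) *\<^sub>R g j)"
proof -
  have second: "g j - 2 *\<^sub>R g (Suc j) + g (Suc (Suc j)) = (g j - g (Suc j)) - (g (Suc j) - g (Suc (Suc j)))"
    for j by (simp add: scaleR_2)
  show ?thesis
    unfolding second alternating_binomial_sum_diff[of n "\<lambda>j. g j - g (Suc j)"]
    by (rule alternating_binomial_sum_diff)
qed

lemma cosine_apply:
  assumes "cosine_family C"
  shows "2 *\<^sub>R C t (C s x) = C (t + s) x + C (t - s) x"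
proof -
  have "2 *\<^sub>R (C t o\<^sub>L C s) = C (t + s) + C (t - s)"
    using assms by (auto simp: cosine_family_def)
  then have "(2 *\<^sub>R (C t o\<^sub>L C s)) x = (C (t + s) + C (t - s)) x"
    by simp
  then show ?thesis
    by (simp add: scaleR_blinfun.rep_eq plus_blinfun.rep_eq)
qed

lemma cosine_zero: "cosine_family C \<Longrightarrow> C 0 x = x"
  by (simp add: cosine_family_def)

lemma cosine_even:
  assumes "cosine_family C"
  shows "C (- t) = C t"
proof (rule blinfun_eqI)
  show "C (- t) x = C t x" for x
    using cosine_apply[OF assms, of 0 t x] by (simp add: cosine_zero[OF assms] scaleR_2)
qed

text \<open>The operator analogue of \<open>1 - cos \<theta> = -(e\<^bsup>i\<theta>/2\<^esup> - e\<^bsup>-i\<theta>/2\<^esup>)\<^sup>2 / 2\<close> raised to the power \<open>k\<close>: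
  multiplying \<open>C(a)\<close> by \<open>I - C(t)\<close> takes minus one half of a second difference with step \<open>t\<close>.\<close>

lemma cosine_power_expansion:
  assumes "cosine_family C"
  shows "((\<lambda>v. v - C t v) ^^ k) y
       = (\<Sum>j\<le>2*k. ((-1)^j * real ((2*k) choose j)) *\<^sub>R ((-1/2)^k *\<^sub>R C ((real k - real j) * t) y))"
proof (induction k)
  case 0
  show ?case by (simp add: cosine_zero[OF assms])
next
  case (Suc k)
  let ?b = "\<lambda>n j. (-1)^j * real (n choose j)"
  define g where "g j = (-1/2)^Suc k *\<^sub>R C ((real (Suc k) - real j) * t) y" for j
  have step: "(-1/2)^k *\<^sub>R (C a y - C t (C a y))
      = (-1/2)^Suc k *\<^sub>R (C (a + t) y - 2 *\<^sub>R C a y + C (a - t) y)" for a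
  proof -
    have "2 *\<^sub>R C t (C a y) = C (a + t) y + C (a - t) y"
      using cosine_apply[OF assms, of t a y] cosine_even[OF assms, of "a - t"]
      by (simp add: add.commute)
    then have "C (a + t) y - 2 *\<^sub>R C a y + C (a - t) y = (-2) *\<^sub>R (C a y - C t (C a y))"
      by (simp add: algebra_simps)
    then show ?thesis by simp
  qed
  have "((\<lambda>v. v - C t v) ^^ Suc k) y
      = (\<Sum>j\<le>2*k. ?b (2*k) j *\<^sub>R
          ((-1/2)^k *\<^sub>R (C ((real k - real j) * t) y - C t (C ((real k - real j) * t) y))))"
    by (simp add: Suc.IH blinfun.sum_right blinfun.scaleR_right sum_subtractf scaleR_diff_right)
  also have "\<dots> = (\<Sum>j\<le>2*k. ?b (2*k) j *\<^sub>R (g j - 2 *\<^sub>R g (Suc j) + g (Suc (Suc j))))"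
    by (intro sum.cong refl, subst step) (simp add: g_def algebra_simps)
  also have "\<dots> = (\<Sum>j\<le>2 * Suc k. ?b (2 * Suc k) j *\<^sub>R g j)"
    using alternating_binomial_sum_second_diff[of "2*k" g] by simp
  finally show ?case by (simp add: g_def)
qed

section \<open>Oscillating terms have small integrals\<close>

text \<open>The integrals of the two translates cancel except on two end pieces of length \<open>r\<close>.\<close>

lemma norm_integral_translate_diff_le:
  fixes f :: "real \<Rightarrow> 'v::banach"
  assumes cont: "continuous_on UNIV f"
    and "0 \<le> r" "0 \<le> h" "0 \<le> B"
    and bound: "\<And>t. a \<le> t \<Longrightarrow> t \<le> a + h + r \<Longrightarrow> norm (f t) \<le> B"
  shows "norm (integral {a..a + h} (\<lambda>t. f (t + r) - f t)) \<le> 2 * r * B"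
proof -
  have int: "f integrable_on {u..v}" for u v
    by (rule integrable_continuous_real) (rule continuous_on_subset[OF cont], simp)
  have int_r: "(\<lambda>t. f (t + r)) integrable_on {u..v}" for u v
    by (rule integrable_continuous_real)
       (intro continuous_on_compose2[OF cont] continuous_intros, simp)
  have "integral {a..a + h} (\<lambda>t. f (t + r)) = integral {a + r..a + h + r} f"
    using integral_shift_Icc_real[of "a" "a + h" f r] by (simp add: o_def add.commute)
  moreover have "integral {a..a + r} f + integral {a + r..a + h + r} f = integral {a..a + h + r} f"
    by (rule Henstock_Kurzweil_Integration.integral_combine[OF _ _ int]) (use assms in auto)
  then have "integral {a + r..a + h + r} f = integral {a..a + h + r} f - integral {a..a + r} f"
    by (simp add: eq_diff_eq add.commute)
  moreover have "integral {a..a + h} f + integral {a + h..a + h + r} f = integral {a..a + h + r} f"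
    by (rule Henstock_Kurzweil_Integration.integral_combine[OF _ _ int]) (use assms in auto)
  then have "integral {a..a + h} f = integral {a..a + h + r} f - integral {a + h..a + h + r} f"
    by (simp add: eq_diff_eq)
  ultimately have "integral {a..a + h} (\<lambda>t. f (t + r) - f t)
      = integral {a + h..a + h + r} f - integral {a..a + r} f"
    by (simp add: integral_diff int int_r)
  moreover have "norm (integral {a + h..a + h + r} f) \<le> B * r"
    using integral_bound[of "a + h" "a + h + r" f B] assms by (auto intro: continuous_on_subset)
  moreover have "norm (integral {a..a + r} f) \<le> B * r"
    using integral_bound[of a "a + r" f B] assms by (auto intro: continuous_on_subset)
  ultimately show ?thesis
    using norm_triangle_ineq4[of "integral {a + h..a + h + r} f" "integral {a..a + r} f"]
    by (simp add: mult.commute)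
qed

lemma strongly_continuous_continuous_on:
  assumes "strongly_continuous C"
  shows "continuous_on UNIV (\<lambda>t. C t x)"
  using assms unfolding strongly_continuous_def
  by (auto simp: continuous_on_eq_continuous_at isCont_iff)

text \<open>By the cosine equation \<open>C(mt)(C(s)x - x)\<close> is half a second difference with step \<open>s\<close> of the
  orbit at \<open>mt\<close>.  In the variable \<open>t\<close> this is a translation by \<open>s/m\<close>, and integration
  telescopes: only the ends of the interval, of total length \<open>O(s)\<close>, contribute.\<close>

lemma norm_integral_cosine_increment_le:
  fixes C :: "real \<Rightarrow> 'a::banach \<Rightarrow>\<^sub>L 'a"
  assumes cos: "cosine_family C" and sc: "strongly_continuous C"
    and m: "1 \<le> m" and s: "0 \<le> s" and h: "0 \<le> h" and M: "0 \<le> M"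
    and bound: "\<And>t. \<bar>t\<bar> \<le> m * h + s \<Longrightarrow> norm (C t) \<le> M"
  shows "norm (integral {0..h} (\<lambda>t. C (m * t) (C s x - x))) \<le> 2 * s * M * norm x"
proof -
  define f where "f t = C (m * t) x" for t
  define r where "r = s / m"
  have r: "0 \<le> r" "r \<le> s" "m * r = s"
    using m s divide_left_mono[of 1 m s] by (auto simp: r_def)
  have cont: "continuous_on UNIV f"
    unfolding f_def
    by (intro continuous_on_compose2[OF strongly_continuous_continuous_on[OF sc]] continuous_intros) auto
  have fb: "norm (f t) \<le> M * norm x" if "- r \<le> t" "t \<le> h + r" for t
  proof -
    have "m * t \<le> m * (h + r)" "m * (- r) \<le> m * t"
      using that m by (intro mult_left_mono; simp)+
    moreover have "0 \<le> m * h" using m h by simp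
    ultimately have "\<bar>m * t\<bar> \<le> m * h + s"
      using r by (simp add: algebra_simps abs_le_iff)
    from bound[OF this] show ?thesis
      unfolding f_def by (meson mult_right_mono norm_blinfun norm_ge_zero order_trans)
  qed
  have int: "(\<lambda>t. f (t + d) - f (t + e)) integrable_on {0..h}" for d e
    by (rule integrable_continuous_real)
       (intro continuous_intros continuous_on_compose2[OF cont] subset_UNIV)
  have fwd: "norm (integral {0..h} (\<lambda>t. f (t + r) - f t)) \<le> 2 * r * (M * norm x)"
    using norm_integral_translate_diff_le[OF cont, of r h "M * norm x" 0] r h M fb by auto
  have "norm (integral {- r..- r + h} (\<lambda>t. f (t + r) - f t)) \<le> 2 * r * (M * norm x)"
    using norm_integral_translate_diff_le[OF cont, of r h "M * norm x" "- r"] r h M fb by auto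
  then have bwd: "norm (integral {0..h} (\<lambda>t. f t - f (t - r))) \<le> 2 * r * (M * norm x)"
    using integral_shift_Icc_real[of 0 h "\<lambda>t. f (t + r) - f t" "- r"] by (simp add: o_def algebra_simps)
  have "C (m * t) (C s x - x) = (1/2) *\<^sub>R ((f (t + r) - f t) - (f t - f (t - r)))" for t
  proof -
    have "C (m * t) (C s x) = (1/2) *\<^sub>R (C (m * t + s) x + C (m * t - s) x)"
      using cosine_apply[OF cos, of "m * t" s x] by (metis scaleR_half_double scaleR_right.add scaleR_2)
    then show ?thesis
      using r by (simp add: f_def blinfun.diff_right algebra_simps flip: scaleR_add_left)
  qed
  then have "integral {0..h} (\<lambda>t. C (m * t) (C s x - x))
      = (1/2) *\<^sub>R (integral {0..h} (\<lambda>t. f (t + r) - f t) - integral {0..h} (\<lambda>t. f t - f (t - r)))"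
    using int[of r 0] int[of 0 "- r"] by (simp add: integral_diff)
  then have "norm (integral {0..h} (\<lambda>t. C (m * t) (C s x - x))) \<le> 2 * r * (M * norm x)"
    using fwd bwd norm_triangle_ineq4[of "integral {0..h} (\<lambda>t. f (t + r) - f t)"
      "integral {0..h} (\<lambda>t. f t - f (t - r))"] by simp
  also have "\<dots> \<le> 2 * s * (M * norm x)"
    using r M by (intro mult_right_mono) auto
  finally show ?thesis by (simp add: mult.assoc)
qed

section \<open>The mean beats the norm bound\<close>

text \<open>The number on the right is the mean of \<open>(1 - cos \<theta>)\<^sup>k\<close> over a period.  It grows like \<open>2\<^sup>k\<close> up to
  a polynomial factor, hence faster than every power of a smaller base.\<close>

lemma ex_power_less_central_binomial:
  fixes c :: real
  assumes "0 \<le> c" "c < 2"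
  shows "\<exists>k. c ^ k < real ((2*k) choose k) / 2 ^ k"
proof -
  have "(\<lambda>k. real k * (c / 2) ^ k) \<longlonglongrightarrow> 0"
    using assms by (intro powser_times_n_limit_0) auto
  then have "eventually (\<lambda>k. real k * (c / 2) ^ k < 1 / 2) sequentially"
    by (rule order_tendstoD) simp
  then have "eventually (\<lambda>k. 0 < k \<and> real k * (c / 2) ^ k < 1 / 2) sequentially"
    using eventually_gt_at_top[of 0] by eventually_elim auto
  then obtain k where k: "0 < k" "real k * (c / 2) ^ k < 1 / 2"
    by (auto simp: eventually_sequentially)
  have "(4::real) ^ k = 2 ^ k * 2 ^ k"
    by (simp flip: power_mult_distrib)
  have "c ^ k < 2 ^ k / (2 * real k)"
    using k by (simp add: power_divide field_simps)
  also have "\<dots> = (4 ^ k / (2 * real k)) / 2 ^ k"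
    using \<open>4 ^ k = 2 ^ k * 2 ^ k\<close> by simp
  also have "\<dots> \<le> real ((2*k) choose k) / 2 ^ k"
    using central_binomial_lower_bound[OF k(1)] by (intro divide_right_mono) auto
  finally show ?thesis by blast
qed

text \<open>The quantitative form: any gap between the mean \<open>(2k choose k) / 2\<^sup>k\<close> and the bound \<open>c\<^sup>k\<close> of
  \<open>(I - C(t))\<^sup>k\<close> turns into a Lipschitz estimate at \<open>0\<close>.
  The bound \<open>kh + s\<close> is the largest modulus among the arguments \<open>(k - j) t \<plusminus> s\<close> for \<open>t \<in> [0, h]\<close>.\<close>

lemma norm_cosine_increment_le:
  fixes C :: "real \<Rightarrow> 'a::banach \<Rightarrow>\<^sub>L 'a"
  assumes cos: "cosine_family C" and sc: "strongly_continuous C"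
    and c: "0 \<le> c" and h: "0 < h" and s: "0 \<le> s"
    and near: "\<And>t. \<bar>t\<bar> \<le> real k * h + s \<Longrightarrow> norm (C t - id_blinfun) \<le> c"
    and k: "1 \<le> k"
  shows "(real ((2*k) choose k) / 2 ^ k - c ^ k) * norm (C s x - x)
       \<le> 2 ^ k * (2 * (c + 1)) * s / h * norm x"
proof -
  define y where "y = C s x - x"
  let ?b = "\<lambda>j. (-1)^j * real ((2*k) choose j)"
  let ?R = "{..2*k} - {k}"
  let ?T = "\<lambda>j t. ?b j *\<^sub>R ((-1/2)^k *\<^sub>R C ((real k - real j) * t) y)"
  let ?D = "\<lambda>t. ((\<lambda>v. v - C t v) ^^ k) y"
  let ?beta = "real ((2*k) choose k) / 2 ^ k"
  have bound: "norm (C t) \<le> c + 1" if "\<bar>t\<bar> \<le> real k * h + s" for t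
    using near[OF that] norm_triangle_ineq[of "C t - id_blinfun" id_blinfun]
      norm_blinfun_id_le[where 'a='a] by simp
  have cont: "continuous_on UNIV (\<lambda>t. C (a * t) y)" for a
    by (intro continuous_on_compose2[OF strongly_continuous_continuous_on[OF sc]] continuous_intros) auto
  have contT: "continuous_on {0..h} (?T j)" for j
    by (intro continuous_intros continuous_on_subset[OF cont]) auto
  then have intT: "(?T j) integrable_on {0..h}" for j
    by (rule integrable_continuous_real)
  have D_eq: "?D t = (\<Sum>j\<le>2*k. ?T j t)" for t
    by (rule cosine_power_expansion[OF cos])
  have D_norm: "norm (((\<lambda>v. v - C t v) ^^ i) y) \<le> c ^ i * norm y" if "t \<in> {0..h}" for t i
  proof (induction i)
    case (Suc i)
    let ?v = "((\<lambda>v. v - C t v) ^^ i) y"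
    have "t * 1 \<le> h * real k"
      using that k h by (intro mult_mono) auto
    then have "norm (C t - id_blinfun) \<le> c"
      using that s by (intro near) (simp add: mult.commute)
    then have "norm ((C t - id_blinfun) ?v) \<le> c * norm ?v"
      by (meson mult_right_mono norm_blinfun norm_ge_zero order_trans)
    also have "\<dots> \<le> c * (c ^ i * norm y)"
      using Suc.IH c by (rule mult_left_mono)
    finally show ?case
      by (simp add: blinfun.diff_left norm_minus_commute mult.assoc)
  qed simp
  have "continuous_on {0..h} ?D"
    unfolding D_eq by (intro continuous_on_sum contT)
  then have ID: "norm (integral {0..h} ?D) \<le> c ^ k * norm y * h"
    using integral_bound[of 0 h ?D "c ^ k * norm y"] D_norm h by simp
  \<comment> \<open>The terms for \<open>j\<close> and \<open>2k - j\<close> agree since \<open>C\<close> is even, so that the factor of \<open>t\<close> may be taken positive.\<close>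
  have IC: "norm (integral {0..h} (\<lambda>t. C ((real k - real j) * t) y)) \<le> 2 * s * (c + 1) * norm x"
    if j: "j \<in> ?R" for j
  proof -
    let ?m = "\<bar>real k - real j\<bar>"
    have "C ((real k - real j) * t) = C (?m * t)" for t
      using cosine_even[OF cos, of "(real k - real j) * t"]
      by (simp add: abs_if left_diff_distrib)
    moreover have "?m \<le> real k" "1 \<le> ?m"
      using j by (auto simp: abs_if)
    moreover from this have "?m * h \<le> real k * h"
      using h by (intro mult_right_mono) auto
    then have "norm (C t) \<le> c + 1" if "\<bar>t\<bar> \<le> ?m * h + s" for t
      using that by (intro bound) simp
    ultimately show ?thesis
      unfolding y_def
      using norm_integral_cosine_increment_le[OF cos sc, of ?m s h "c + 1" x] s h c by simp
  qed
  have IT: "norm (integral {0..h} (?T j))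
      \<le> real ((2*k) choose j) * ((1/2)^k * (2 * s * (c + 1) * norm x))" if "j \<in> ?R" for j
    using mult_left_mono[OF IC[OF that], of "real ((2*k) choose j) * (1/2)^k"]
    by (simp add: power_abs abs_mult mult.assoc)
  have rows: "real (\<Sum>j\<le>2*k. (2*k) choose j) = 2 ^ k * 2 ^ k"
    by (simp add: choose_row_sum power_mult flip: power_mult_distrib)
  have "integral {0..h} (\<lambda>t. \<Sum>j\<in>?R. ?T j t) = (\<Sum>j\<in>?R. integral {0..h} (?T j))"
    by (rule integral_sum) (simp, rule intT)
  also have "norm \<dots>
      \<le> (\<Sum>j\<in>?R. real ((2*k) choose j) * ((1/2)^k * (2 * s * (c + 1) * norm x)))"
    by (rule sum_norm_le) (rule IT)
  also have "\<dots> \<le> (\<Sum>j\<le>2*k. real ((2*k) choose j) * ((1/2)^k * (2 * s * (c + 1) * norm x)))"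
    using s c by (intro sum_mono2) auto
  also have "\<dots> = real (\<Sum>j\<le>2*k. (2*k) choose j) * ((1/2)^k * (2 * s * (c + 1) * norm x))"
    by (simp add: sum_distrib_right)
  also have "\<dots> = 2 ^ k * (2 * s * (c + 1) * norm x)"
    unfolding rows by (simp add: power_divide)
  finally have IR: "norm (integral {0..h} (\<lambda>t. \<Sum>j\<in>?R. ?T j t)) \<le> 2 ^ k * (2 * s * (c + 1) * norm x)" .
  have "(-1) ^ k * (-1/2) ^ k = (1/2::real) ^ k"
    by (simp flip: power_mult_distrib)
  then have "real ((2*k) choose k) * ((-1) ^ k * (-1/2) ^ k) = ?beta"
    by (simp only:) (simp add: power_one_over)
  then have "?b k * (-1/2) ^ k = ?beta"
    by (simp only: mult_ac)
  then have "?T k t = ?beta *\<^sub>R y" for t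
    by (simp only: scaleR_scaleR diff_self mult_zero_left cosine_zero[OF cos])
  then have split: "?beta *\<^sub>R y = ?D t - (\<Sum>j\<in>?R. ?T j t)" for t
    unfolding D_eq by (subst sum.remove[of _ k]) auto
  have "integral {0..h} (\<lambda>t. ?beta *\<^sub>R y)
      = integral {0..h} (\<lambda>t. ?D t - (\<Sum>j\<in>?R. ?T j t))"
    by (intro integral_cong split)
  also have "\<dots> = integral {0..h} ?D - integral {0..h} (\<lambda>t. \<Sum>j\<in>?R. ?T j t)"
    unfolding D_eq by (intro integral_diff integrable_sum intT) auto
  finally have mean: "h *\<^sub>R ?beta *\<^sub>R y = \<dots>"
    using h by (simp add: mult.commute)
  have "norm (h *\<^sub>R ?beta *\<^sub>R y) \<le> c ^ k * norm y * h + 2 ^ k * (2 * s * (c + 1) * norm x)"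
    unfolding mean by (intro norm_triangle_le_diff add_mono ID IR)
  then have "h * (?beta * norm y) \<le> c ^ k * norm y * h + 2 ^ k * (2 * s * (c + 1) * norm x)"
    using h by simp
  then have "h * ((?beta - c ^ k) * norm y) \<le> 2 ^ k * (2 * (c + 1)) * s * norm x"
    by (simp add: algebra_simps)
  then show ?thesis
    using h by (simp add: y_def pos_le_divide_eq mult.commute)
qed

theorem theorem1p1:
  fixes C :: "real \<Rightarrow> 'a::banach \<Rightarrow>\<^sub>L 'a"
  assumes "cosine_family C"
    and "strongly_continuous C"
    and "Limsup (at_right 0) (\<lambda>t. ereal (norm (C t - id_blinfun))) < 2"
  shows "((\<lambda>t. norm (C t - id_blinfun)) \<longlongrightarrow> 0) (at_right 0)"
proof -
  obtain c' where c': "Limsup (at_right 0) (\<lambda>t. ereal (norm (C t - id_blinfun))) < ereal c'" "ereal c' < 2"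
    using ereal_dense2[OF assms(3)] by auto
  define c where "c = max c' 0"
  have c: "0 \<le> c" "c < 2"
    using c'(2) by (auto simp: c_def)
  have "eventually (\<lambda>t. norm (C t - id_blinfun) < c') (at_right 0)"
    using Limsup_lessD[OF c'(1)] by simp
  then obtain d where d: "0 < d" "\<And>t. 0 < t \<Longrightarrow> t < d \<Longrightarrow> norm (C t - id_blinfun) < c'"
    by (auto simp: eventually_at_right_field)
  have near: "norm (C t - id_blinfun) \<le> c" if "\<bar>t\<bar> < d" for t
  proof (cases "t = 0")
    case True
    then show ?thesis using assms(1) c by (simp add: cosine_family_def)
  next
    case False
    then have "norm (C \<bar>t\<bar> - id_blinfun) < c'"
      using d that by auto
    moreover have "C \<bar>t\<bar> = C t"
      using cosine_even[OF assms(1), of t] by (simp add: abs_if)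
    ultimately show ?thesis by (simp add: c_def)
  qed
  obtain k where k: "c ^ k < real ((2*k) choose k) / 2 ^ k"
    using ex_power_less_central_binomial[OF c] by auto
  \<comment> \<open>For \<open>k = 0\<close> both sides are \<open>1\<close>.\<close>
  have k1: "1 \<le> k"
    using k by (cases k) auto
  define gap where "gap = real ((2*k) choose k) / 2 ^ k - c ^ k"
  have gap: "0 < gap"
    using k by (simp add: gap_def)
  \<comment> \<open>Small enough that \<open>kh + s < d\<close> whenever \<open>s < d / 2\<close>.\<close>
  define h where "h = d / (2 * real k)"
  have h: "0 < h" "real k * h = d / 2"
    using d k1 by (auto simp: h_def)
  define K where "K = 2 ^ k * (2 * (c + 1)) / h / gap"
  have lip: "norm (C s - id_blinfun) \<le> K * s" if s: "0 < s" "s < d / 2" for s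
  proof (rule norm_blinfun_bound)
    show "0 \<le> K * s"
      using s c h gap by (simp add: K_def)
    fix x
    have "gap * norm (C s x - x) \<le> 2 ^ k * (2 * (c + 1)) * s / h * norm x"
      unfolding gap_def
      by (rule norm_cosine_increment_le[OF assms(1,2) c(1) h(1) _ _ k1])
         (use s h near in auto)
    then show "norm ((C s - id_blinfun) x) \<le> K * s * norm x"
      using gap h by (simp add: K_def blinfun.diff_left field_simps)
  qed
  show ?thesis
  proof (rule tendsto_sandwich[OF _ _ tendsto_const])
    show "eventually (\<lambda>t. norm (C t - id_blinfun) \<le> K * t) (at_right 0)"
      using d(1) lip by (auto simp: eventually_at_right_field intro!: exI[of _ "d / 2"])
    show "((\<lambda>t. K * t) \<longlongrightarrow> 0) (at_right 0)"
      by (auto intro!: tendsto_eq_intros)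
  qed auto
qed

end
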